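(* There exist constants $K,C>0$ such that for all integers $m\ge 2$ and $l\ge 1$ there is an oriented graph $D$ on $n=ml$ vertices which contains no oriented four-cycle, whose number of arcs satisfies $\frac{1}{20}m^{3/2}l^{2}\le e(D)\le C m^{3/2}l^{2}$, and which has $bias(D)<K e(D)^{2}/n^{2}$.
   Context: An oriented graph $D$ is a finite directed graph without loops in which, for each pair of distinct vertices $x,y$, at most one of $\vec{xy},\vec{yx}$ is an arc. $V=V(D)$ is the vertex set and $e(D)$ the number of arcs. For (not necessarily disjoint) $A,B\subseteq V$, $e(A,B)$ is the number of arcs $\vec{xy}$ of $D$ with $x\in A$, $y\in B$. Define $$bias(D)=\max\{e(A,B): A,B\subseteq V,\ e(B,A)\le e(A,B)/2\}.$$ An oriented four-cycle is a cyclically (consistently) oriented cycle on four distinct vertices, i.e. arcs $\vec{v_1v_2},\vec{v_2v_3},\vec{v_3v_4},\vec{v_4v_1}$. *)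

theory Defs
  imports Complex_Main "Graph_Theory.Pair_Digraph"
begin

text \<open>In a pair digraph the arcs are ordered pairs of vertices, so there are no parallel arcs.\<close>

definition oriented_graph :: "'a pair_pre_digraph \<Rightarrow> bool" where
  "oriented_graph D \<longleftrightarrow> pair_digraph D \<and> antisym (parcs D)"

definition arcs_between :: "'a pair_pre_digraph \<Rightarrow> 'a set \<Rightarrow> 'a set \<Rightarrow> nat" where
  "arcs_between D A B = card {(x, y) \<in> parcs D. x \<in> A \<and> y \<in> B}"

definition bias :: "'a pair_pre_digraph \<Rightarrow> nat" where
  "bias D = Max {arcs_between D A B | A B. A \<subseteq> pverts D \<and> B \<subseteq> pverts D
      \<and> real (arcs_between D B A) \<le> real (arcs_between D A B) / 2}"

definition has_oriented_four_cycle :: "'a pair_pre_digraph \<Rightarrow> bool" where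
  "has_oriented_four_cycle D \<longleftrightarrow> (\<exists>v1 v2 v3 v4. distinct [v1, v2, v3, v4]
      \<and> {(v1, v2), (v2, v3), (v3, v4), (v4, v1)} \<subseteq> parcs D)"

text \<open>The maximum in the definition of \<^const>\<open>bias\<close> is over a finite nonempty set
  (take both sets empty), so it is attained.\<close>

lemma bias_set_finite_nonempty:
  assumes "finite (pverts D)"
  defines "S \<equiv> {arcs_between D A B | A B. A \<subseteq> pverts D \<and> B \<subseteq> pverts D
      \<and> real (arcs_between D B A) \<le> real (arcs_between D A B) / 2}"
  shows "finite S" "S \<noteq> {}"
proof -
  have "S \<subseteq> (\<lambda>(A, B). arcs_between D A B) ` (Pow (pverts D) \<times> Pow (pverts D))"
    unfolding S_def by auto
  then show "finite S"
    using assms(1) by (meson finite_Pow_iff finite_SigmaI finite_imageI finite_subset)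
  have "arcs_between D {} {} \<in> S"
    unfolding S_def by (auto simp: arcs_between_def intro!: exI[of _ "{}"])
  then show "S \<noteq> {}" by blast
qed

end

(* Take a four-cycle free graph on m vertices with about m^(3/2) edges; for q = 2^k these are the
   pairs (x, y), (a, b) over the field of order q with y + b = a x. Orient its edges at random. For
   fixed A and B the variable 2 e(A,B) - 3 e(B,A) has negative drift along each edge, so it exceeds
   a large multiple of m only with probability below 4^(-m), and a union bound over all pairs (A, B)
   gives an orientation with 2 e(A,B) - 3 e(B,A) <= 15 m throughout. This inequality is bilinear, so
   it survives blowing up each vertex into l copies with 15 m l^2 on the right, and together with
   e(B,A) <= e(A,B) / 2 it bounds e(A,B) by 30 m l^2. *)

theory Submission
  imports Defs "HOL-Library.Z2" "HOL-Algebra.Algebraic_Closure_Type"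
begin

section \<open>Fields of order a power of two\<close>

text \<open>Induction on the degree by splitting off a root \<open>r\<close> with cofactor
  \<open>s\<close>. At \<open>r\<close> the derivative of \<open>p\<close> equals
  \<open>poly s r\<close>, so \<open>r\<close> is not a root of \<open>s\<close>; at a root
  \<open>a\<close> of \<open>s\<close> it equals \<open>(a - r) * poly (pderiv s) a\<close>, so the
  hypothesis passes on to \<open>s\<close>.\<close>

lemma card_roots_eq_degree:
  fixes p :: "'a :: alg_closed_field poly"
  assumes "p \<noteq> 0" "\<And>a. poly p a = 0 \<Longrightarrow> poly (pderiv p) a \<noteq> 0"
  shows "card {x. poly p x = 0} = degree p"
  using assms
proof (induction "degree p" arbitrary: p)
  case 0
  then obtain c where "p = [:c:]" "c \<noteq> 0"
    by (metis degree_eq_zeroE pCons_0_0)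
  then show ?case by simp
next
  case (Suc n)
  then obtain r where r: "poly p r = 0"
    using alg_closed_imp_poly_has_root[of p] by auto
  then obtain s where p: "p = [:-r, 1:] * s"
    by (meson dvdE poly_eq_0_iff_dvd)
  have s0: "s \<noteq> 0" using p Suc.prems by auto
  have dp: "poly (pderiv p) a = poly s a + (a - r) * poly (pderiv s) a" for a
    unfolding p pderiv_mult by (simp add: pderiv_pCons algebra_simps)
  have deg: "degree p = Suc (degree s)"
    unfolding p using s0 by (subst degree_mult_eq) auto
  have "card {x. poly s x = 0} = degree s"
  proof (rule Suc.hyps(1))
    show "n = degree s" using deg Suc.hyps(2) by simp
    show "poly (pderiv s) a \<noteq> 0" if "poly s a = 0" for a
      using Suc.prems(2)[of a] that dp[of a] by (auto simp: p)
  qed (rule s0)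
  moreover have "poly s r \<noteq> 0"
    using Suc.prems(2)[OF r] dp[of r] by simp
  moreover have "{x. poly p x = 0} = insert r {x. poly s x = 0}"
    by (auto simp: p)
  ultimately show ?case
    using deg poly_roots_finite[OF s0] by simp
qed

text \<open>In characteristic two the polynomial x^q - x has derivative -1, so all its roots are
  simple. They form the subfield of order q = 2^k.\<close>

lemma card_frobenius_fixed:
  assumes "CHAR('a :: alg_closed_field) = 2" "k > 0"
  shows "card {x :: 'a. x ^ (2 ^ k) = x} = 2 ^ k"
proof -
  let ?q = "2 ^ k :: nat"
  let ?p = "monom 1 ?q - monom 1 1 :: 'a poly"
  have q: "?q > 1" by (rule one_less_power) (use assms(2) in auto)
  have deg: "degree ?p = ?q"
    using q degree_add_eq_left[of "- monom 1 1" "monom 1 ?q :: 'a poly"]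
    by (simp add: degree_monom_eq)
  have "(of_nat ?q :: 'a) = 0"
    using assms by (simp add: of_nat_eq_0_iff_char_dvd del: of_nat_power)
  then have "pderiv ?p = - 1"
    by (simp add: pderiv_diff pderiv_monom monom_0 one_pCons del: of_nat_power)
  then have "card {x. poly ?p x = 0} = degree ?p"
    using deg q by (intro card_roots_eq_degree) auto
  then show ?thesis using deg by (simp add: poly_monom)
qed

text \<open>Subtraction is addition in characteristic two, so the additivity of the Frobenius map
  applies.\<close>

lemma frobenius_fixed_diff:
  fixes x y :: "'a :: field"
  assumes "CHAR('a) = 2" "x ^ (2 ^ k) = x" "y ^ (2 ^ k) = y"
  shows "(x - y) ^ (2 ^ k) = x - y"
  using freshmans_dream'[of "2 ^ k" k x y] assms by (simp add: minus_CHAR_2)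

section \<open>Dense graphs without four-cycles\<close>

text \<open>Phrased for closed walks of length four, which have to backtrack, instead of cycles on
  distinct vertices. It therefore applies directly to the projection of a four-cycle from a blow-up,
  where vertices may coincide.\<close>

definition four_cycle_free :: "'a rel \<Rightarrow> bool" where
  "four_cycle_free E \<longleftrightarrow> (\<forall>a b c d. (a, b) \<in> E \<longrightarrow> (b, c) \<in> E \<longrightarrow> (c, d) \<in> E \<longrightarrow> (d, a) \<in> E
     \<longrightarrow> a = c \<or> b = d)"

text \<open>Incidence between points \<open>u\<close> and non-vertical lines coded by
  \<open>v\<close>, made symmetric by a polarity. Loops may occur.\<close>

definition parabola_rel :: "'a :: field set \<Rightarrow> ('a \<times> 'a) rel" where
  "parabola_rel S = {(u, v). u \<in> S \<times> S \<and> v \<in> S \<times> S \<and> snd u + snd v = fst u * fst v}"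

text \<open>The alternating sum of the four equations is
  \<open>(fst a - fst c) * (fst b - fst d) = 0\<close>. Opposite vertices with equal first
  coordinates also have equal second ones, because they share a neighbour.\<close>

lemma four_cycle_free_parabola_rel: "four_cycle_free (parabola_rel S)"
  unfolding four_cycle_free_def
proof (intro allI impI)
  fix a b c d
  assume *: "(a, b) \<in> parabola_rel S" "(b, c) \<in> parabola_rel S"
    "(c, d) \<in> parabola_rel S" "(d, a) \<in> parabola_rel S"
  then have e: "snd a + snd b = fst a * fst b" "snd b + snd c = fst b * fst c"
    "snd c + snd d = fst c * fst d" "snd d + snd a = fst d * fst a"
    by (auto simp: parabola_rel_def)
  have "(fst a - fst c) * (fst b - fst d)
      = fst a * fst b - fst b * fst c + fst c * fst d - fst d * fst a"
    by (simp add: algebra_simps)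
  also have "\<dots> = 0"
    unfolding e[symmetric] by simp
  finally have "(fst a - fst c) * (fst b - fst d) = 0" .
  then consider "fst a = fst c" | "fst b = fst d" by auto
  then show "a = c \<or> b = d"
  proof cases
    case 1
    then have "snd a = snd c" using e(1,2) by (metis add.commute add_left_cancel mult.commute)
    with 1 show ?thesis by (simp add: prod_eq_iff)
  next
    case 2
    then have "snd b = snd d" using e(1,4) by (metis add.commute add_left_cancel mult.commute)
    with 2 show ?thesis by (simp add: prod_eq_iff)
  qed
qed

text \<open>The coordinates \<open>x\<close>, \<open>y\<close>, \<open>a\<close> are free and
  determine the fourth, \<open>x * a - y\<close>.\<close>

lemma card_parabola_rel:
  assumes "\<And>x y. x \<in> S \<Longrightarrow> y \<in> S \<Longrightarrow> x * y \<in> S" "\<And>x y. x \<in> S \<Longrightarrow> y \<in> S \<Longrightarrow> x - y \<in> S"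
  shows "card (parabola_rel S) = card S ^ 3"
proof -
  have "bij_betw (\<lambda>(x, y, a). ((x, y), (a, x * a - y))) (S \<times> S \<times> S) (parabola_rel S)"
    by (rule bij_betw_byWitness[where f' = "\<lambda>((x, y), (a, b)). (x, y, a)"])
      (auto simp: parabola_rel_def assms algebra_simps)
  then show ?thesis
    by (simp add: bij_betw_same_card[symmetric] card_cartesian_product power3_eq_cube)
qed

text \<open>A loop at \<open>(x, y)\<close> means \<open>y + y = x * x\<close>; in characteristic
  two this says \<open>x = 0\<close>, with \<open>y\<close> arbitrary.\<close>

lemma card_parabola_rel_loops:
  assumes "(2 :: 'a :: field) = 0" "0 \<in> S"
  shows "card (parabola_rel S \<inter> Id) = card (S :: 'a set)"
proof -
  have eq: "y + y = 0" for y :: 'a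
    using assms(1) by (metis mult_2 mult_zero_left)
  have "bij_betw (\<lambda>y. ((0, y), (0, y))) S (parabola_rel S \<inter> Id)"
    by (rule bij_betw_byWitness[where f' = "\<lambda>((x, y), (a, b)). y"])
      (auto simp: parabola_rel_def assms eq)
  then show ?thesis by (simp add: bij_betw_same_card[symmetric])
qed

lemma sym_split_strict:
  fixes E :: "'a :: linorder rel"
  assumes "finite E" "sym E"
  shows "card E = 2 * card {(i, j) \<in> E. i < j} + card (E \<inter> Id)"
proof -
  let ?R = "{(i, j) \<in> E. i < j}"
  have "E = (?R \<union> ?R\<inverse>) \<union> (E \<inter> Id)"
    using assms(2) by (auto simp: sym_def)
  moreover have "card ((?R \<union> ?R\<inverse>) \<union> (E \<inter> Id)) = card (?R \<union> ?R\<inverse>) + card (E \<inter> Id)"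
    using assms(1) by (intro card_Un_disjoint) (auto intro: finite_subset)
  moreover have "card (?R \<union> ?R\<inverse>) = card ?R + card (?R\<inverse>)"
    using assms(1) by (intro card_Un_disjoint) (auto intro: finite_subset)
  ultimately show ?thesis by (simp add: card_inverse)
qed

lemma four_cycle_free_subset: "four_cycle_free E \<Longrightarrow> F \<subseteq> E \<Longrightarrow> four_cycle_free F"
  unfolding four_cycle_free_def by blast

text \<open>With q = 2^k, the graph on the q^2 points has q^3 ordered pairs, q of them loops.
  Numbering the points and keeping each remaining edge once, in increasing order, leaves (q^3 - q) /
  2.\<close>

lemma exists_four_cycle_free_power_of_two:
  assumes "k > 0"
  obtains R :: "nat rel" where "R \<subseteq> {..<4 ^ k} \<times> {..<4 ^ k}" "\<And>i j. (i, j) \<in> R \<Longrightarrow> i < j"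
    "four_cycle_free (R \<union> R\<inverse>)" "2 * card R + 2 ^ k = (2 ^ k) ^ 3"
proof -
  \<comment> \<open>The field of order 2^k, realised inside the algebraic closure of the two-element
    field.\<close>
  define S where "S = {x :: bit alg_closure. x ^ (2 ^ k) = x}"
  have char: "CHAR(bit alg_closure) = 2"
    unfolding CHAR_alg_closure
  proof (rule CHAR_eqI)
    show "2 dvd n" if "of_nat n = (0 :: bit)" for n
      using even_of_nat[of n, where 'a = bit] that by simp
  qed simp
  have card_S: "card S = 2 ^ k"
    unfolding S_def using char assms by (rule card_frobenius_fixed)
  have "(2 :: bit alg_closure) = 0"
    using of_nat_CHAR[where 'a = "bit alg_closure"] unfolding char by simp
  moreover have "0 \<in> S" by (simp add: S_def)
  ultimately have loops: "card (parabola_rel S \<inter> Id) = 2 ^ k"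
    by (simp add: card_parabola_rel_loops card_S)
  have card_E: "card (parabola_rel S) = (2 ^ k) ^ 3"
    by (subst card_parabola_rel)
      (auto simp: S_def power_mult_distrib frobenius_fixed_diff[OF char] card_S[unfolded S_def])
  have "finite S" using card_S by (simp add: card_ge_0_finite)
  moreover have "card (S \<times> S) = 4 ^ k"
    by (simp add: card_cartesian_product card_S flip: power_mult_distrib)
  ultimately obtain h where h: "bij_betw h (S \<times> S) {..<4 ^ k :: nat}"
    by (metis finite_cartesian_product ex_bij_betw_finite_nat atLeast0LessThan)
  then have inj: "inj_on h (S \<times> S)" and im: "h ` (S \<times> S) = {..<4 ^ k}"
    by (auto simp: bij_betw_def)
  define E where "E = map_prod h h ` parabola_rel S"
  have sub: "parabola_rel S \<subseteq> (S \<times> S) \<times> (S \<times> S)"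
    by (auto simp: parabola_rel_def)
  have inj2: "inj_on (map_prod h h) (parabola_rel S)"
    using map_prod_inj_on[OF inj inj] sub by (rule inj_on_subset)
  have E_sub: "E \<subseteq> {..<4 ^ k} \<times> {..<4 ^ k}"
    unfolding E_def using sub im by fastforce
  have finE: "finite E" by (rule finite_subset[OF E_sub]) auto
  have symE: "sym E"
    unfolding E_def sym_def by (force simp: parabola_rel_def algebra_simps image_iff)
  have E_iff: "(h u, h v) \<in> E \<longleftrightarrow> (u, v) \<in> parabola_rel S" if "u \<in> S \<times> S" "v \<in> S \<times> S" for u v
    using inj_on_image_mem_iff[OF map_prod_inj_on[OF inj inj] _ sub, of "(u, v)"] that
    by (simp add: E_def)
  have freeE: "four_cycle_free E"
    unfolding four_cycle_free_def
  proof (intro allI impI)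
    fix a b c d
    assume *: "(a, b) \<in> E" "(b, c) \<in> E" "(c, d) \<in> E" "(d, a) \<in> E"
    then have "a \<in> h ` (S \<times> S)" "b \<in> h ` (S \<times> S)" "c \<in> h ` (S \<times> S)" "d \<in> h ` (S \<times> S)"
      using E_sub unfolding im by auto
    then obtain a' b' c' d' where eqs: "a = h a'" "b = h b'" "c = h c'" "d = h d'"
      and mem: "a' \<in> S \<times> S" "b' \<in> S \<times> S" "c' \<in> S \<times> S" "d' \<in> S \<times> S"
      by blast
    have "(a', b') \<in> parabola_rel S" "(b', c') \<in> parabola_rel S"
      "(c', d') \<in> parabola_rel S" "(d', a') \<in> parabola_rel S"
      using * mem by (simp_all add: eqs E_iff)
    then have "a' = c' \<or> b' = d'"
      using four_cycle_free_parabola_rel unfolding four_cycle_free_def by blast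
    then show "a = c \<or> b = d" by (auto simp: eqs)
  qed
  have "card E = (2 ^ k) ^ 3"
    unfolding E_def using inj2 card_E by (simp add: card_image)
  moreover have "E \<inter> Id = map_prod h h ` (parabola_rel S \<inter> Id)"
  proof -
    have "u = v" if "(u, v) \<in> parabola_rel S" "h u = h v" for u v
      using that sub inj_onD[OF inj] by blast
    then show ?thesis unfolding E_def by (force simp: image_iff)
  qed
  then have "card (E \<inter> Id) = 2 ^ k"
    using loops inj_on_subset[OF inj2] by (simp add: card_image)
  moreover define R where "R = {(i, j) \<in> E. i < j}"
  ultimately have "2 * card R + 2 ^ k = (2 ^ k) ^ 3"
    using sym_split_strict[OF finE symE] by simp
  moreover have "R \<union> R\<inverse> \<subseteq> E"
    using symE by (auto simp: R_def sym_def)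
  then have "four_cycle_free (R \<union> R\<inverse>)"
    using freeE four_cycle_free_subset by blast
  ultimately show ?thesis
    using E_sub by (intro that[of R]) (auto simp: R_def)
qed

text \<open>For large \<open>m\<close>, take the largest power 4^k up to \<open>m\<close> and leave
  the other vertices isolated. With q = 2^k and r the root of \<open>m\<close>,
  \<open>q \<le> r \<le> 2 * q\<close>, which costs at most a factor 8 in r^3.\<close>

lemma exists_dense_four_cycle_free:
  fixes m :: nat
  assumes "m \<ge> 2"
  obtains R :: "nat rel" where "R \<subseteq> {..<m} \<times> {..<m}" "\<And>i j. (i, j) \<in> R \<Longrightarrow> i < j"
    "four_cycle_free (R \<union> R\<inverse>)" "1 / 20 * real m powr (3 / 2) \<le> real (card R)"
    "real (card R) \<le> real m powr (3 / 2)"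
proof -
  define r where "r = sqrt (real m)"
  have r: "r \<ge> 0" "r ^ 2 = real m" by (simp_all add: r_def)
  have "real m powr (3 / 2) = (real m powr (1 / 2)) powr 3"
    by (simp add: powr_powr)
  also have "\<dots> = r ^ 3"
    using assms by (simp add: r_def powr_half_sqrt)
  finally have powr: "real m powr (3 / 2) = r ^ 3" .
  show ?thesis
  proof (cases "m < 16")
    case True
    \<comment> \<open>A star has enough edges as long as m is small.\<close>
    let ?R = "Pair (0 :: nat) ` {1..<m}"
    have "r < 4" using True unfolding r_def by (simp add: real_less_lsqrt)
    moreover have "r \<ge> 1" using assms unfolding r_def by simp
    moreover have "r ^ 3 = r * real m" using r by (simp add: power3_eq_cube power2_eq_square)
    moreover have "real (card ?R) = real m - 1"
      using assms by (simp add: card_image inj_on_def of_nat_diff)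
    moreover have "r * real m \<le> 4 * real m" "1 * real m \<le> r * real m"
      using \<open>r < 4\<close> \<open>r \<ge> 1\<close> by (intro mult_right_mono; simp)+
    ultimately have "1 / 20 * r ^ 3 \<le> real (card ?R)" "real (card ?R) \<le> r ^ 3"
      using assms by - linarith+
    then show ?thesis
      using assms
      by (intro that[of ?R]) (auto simp: powr four_cycle_free_def)
  next
    case False
    have "\<exists>k. 4 ^ k \<le> m \<and> m < 4 ^ (k + 1)"
      using assms ex_power_ivl1[of 4 m] by auto
    then obtain k where k: "4 ^ k \<le> m" "m < 4 ^ (k + 1)" by blast
    \<comment> \<open>For k = 1 there would be only 3 edges, while \<open>r \<le> 2 * q\<close>
      bounds r^3 / 20 only by 64 / 20. Hence the star below 16.\<close>
    have k2: "k \<ge> 2"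
    proof (rule ccontr)
      assume "\<not> k \<ge> 2"
      then have "(4 :: nat) ^ (k + 1) \<le> 4 ^ 2" by (intro power_increasing) auto
      with k False show False by simp
    qed
    define q where "q = (2 :: real) ^ k"
    have q4: "q \<ge> 4"
      using power_increasing[OF k2, of "2 :: real"] by (simp add: q_def)
    have q2: "q ^ 2 = 4 ^ k"
      by (simp add: q_def power2_eq_square flip: power_mult_distrib)
    have "real (4 ^ k) \<le> real m" "real m \<le> real (4 ^ (k + 1))"
      using k by (simp_all only: of_nat_le_iff less_imp_le)
    then have "q ^ 2 \<le> r ^ 2" "r ^ 2 \<le> (2 * q) ^ 2"
      by (simp_all add: q2 r power_mult_distrib)
    then have qr: "q \<le> r" "r \<le> 2 * q"
      using power2_le_imp_le[of q r] power2_le_imp_le[of r "2 * q"] r(1) q4 by simp_all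
    have q3: "q ^ 3 \<le> r ^ 3" "r ^ 3 \<le> 8 * q ^ 3"
      using power_mono[OF qr(1), of 3] power_mono[OF qr(2), of 3] r(1) q4
      by (simp_all add: power_mult_distrib)
    have "k > 0" using k2 by simp
    then obtain R :: "nat rel" where R: "R \<subseteq> {..<4 ^ k} \<times> {..<4 ^ k}" "\<And>i j. (i, j) \<in> R \<Longrightarrow> i < j"
      "four_cycle_free (R \<union> R\<inverse>)" "2 * card R + 2 ^ k = (2 ^ k) ^ 3"
      using exists_four_cycle_free_power_of_two by metis
    have "2 * real (card R) + q = q ^ 3"
      using arg_cong[OF R(4), of real] by (simp add: q_def)
    \<comment> \<open>So discarding the loops loses at most a sixteenth: \<open>card R\<close> is at
      least 15/32 q^3, hence at least 15/256 r^3, and 15/256 exceeds 1/20.\<close>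
    moreover have "16 * q \<le> q ^ 3"
    proof -
      have "16 \<le> q ^ 2" using power_mono[OF q4, of 2] by simp
      then have "16 * q \<le> q ^ 2 * q" using q4 by (intro mult_right_mono) auto
      then show ?thesis by (simp add: power3_eq_cube power2_eq_square)
    qed
    ultimately have "1 / 20 * r ^ 3 \<le> real (card R)" "real (card R) \<le> r ^ 3"
      using q3 q4 by - linarith+
    moreover have "R \<subseteq> {..<m} \<times> {..<m}" using R(1) k(1) by auto
    ultimately show ?thesis
      using R(2,3) by (intro that[of R]) (auto simp: powr)
  qed
qed

section \<open>Balanced orientations\<close>

text \<open>The weights 2 and 3 may have any ratio strictly between 1 and 2: above 1 for the negative
  drift, below 2 for the constraint in the bias to leave a positive multiple of e(A, B). The base
  u = 11/10 below satisfies both u^2 + u^(-3) <= 2 and u^15 >= 4.\<close>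

definition imbalance :: "'a set \<Rightarrow> 'a set \<Rightarrow> 'a \<times> 'a \<Rightarrow> real" where
  "imbalance A B = (\<lambda>(x, y). 2 * of_bool (x \<in> A \<and> y \<in> B) - 3 * of_bool (x \<in> B \<and> y \<in> A))"

text \<open>An exponential moment summed over all pairs, which condenses the union bound into one
  number: the summands are nonnegative, so a bound on the sum holds for each pair.\<close>

definition potential :: "'a set \<Rightarrow> 'a rel \<Rightarrow> real" where
  "potential V F = (\<Sum>(A, B)\<in>Pow V \<times> Pow V. \<Prod>e\<in>F. (11 / 10) powr imbalance A B e)"

text \<open>The two exponents are 0 and 0, or -1 and -1, or 2 and -3 in some order; the last case is
  1.21 + 0.7513... < 2.\<close>

lemma powr_imbalance_swap_le: "(11 / 10) powr imbalance A B (x, y) + (11 / 10) powr imbalance A B (y, x) \<le> 2"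
proof -
  have "(11 / 10 :: real) powr 2 = 121 / 100" "(11 / 10 :: real) powr (-3) = 1000 / 1331"
    "(11 / 10 :: real) powr (-1) = 10 / 11"
    by (simp_all add: powr_minus powr_numeral power_numeral_reduce field_simps)
  then show ?thesis by (auto simp: imbalance_def)
qed

text \<open>The two directions of the new arc multiply each summand by factors of mean at most 1, so
  the two new potentials average to at most the old one.\<close>

lemma potential_insert_le:
  assumes "finite F" "(x, y) \<notin> F" "(y, x) \<notin> F"
  shows "potential V (insert (x, y) F) \<le> potential V F \<or> potential V (insert (y, x) F) \<le> potential V F"
proof -
  let ?g = "\<lambda>A B e. (11 / 10) powr imbalance A B e"
  have "potential V (insert (x, y) F) + potential V (insert (y, x) F)
      = (\<Sum>(A, B)\<in>Pow V \<times> Pow V. (?g A B (x, y) + ?g A B (y, x)) * (\<Prod>e\<in>F. ?g A B e))"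
    using assms by (simp add: potential_def case_prod_unfold algebra_simps flip: sum.distrib)
  also have "\<dots> \<le> (\<Sum>(A, B)\<in>Pow V \<times> Pow V. 2 * (\<Prod>e\<in>F. ?g A B e))"
    using powr_imbalance_swap_le
    by (intro sum_mono) (auto simp del: distrib_right simp: prod_nonneg intro!: mult_right_mono)
  also have "\<dots> = 2 * potential V F"
    by (simp add: potential_def sum_distrib_left case_prod_unfold)
  finally show ?thesis by linarith
qed

text \<open>The method of conditional expectations: one of the two orientations of each new edge does not
  increase the potential.\<close>

lemma exists_orientation_low_potential:
  fixes R :: "'a :: linorder rel"
  assumes "finite R" "\<And>x y. (x, y) \<in> R \<Longrightarrow> x < y"
  shows "\<exists>F. F \<subseteq> R \<union> R\<inverse> \<and> antisym F \<and> card F = card R \<and> potential V F \<le> potential V {}"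
  using assms
proof (induction R)
  case empty
  then show ?case by (auto simp: antisym_def)
next
  case (insert e R)
  obtain x y where e: "e = (x, y)" by (cases e)
  obtain F where F: "F \<subseteq> R \<union> R\<inverse>" "antisym F" "card F = card R" "potential V F \<le> potential V {}"
    using insert.IH insert.prems by auto
  \<comment> \<open>Since \<open>R\<close> is strictly increasing, it cannot contain the reversed
    pair either.\<close>
  have new: "(x, y) \<notin> F" "(y, x) \<notin> F"
    using F(1) insert.hyps(2) insert.prems[of x y] insert.prems[of y x] by (auto simp: e)
  have fin: "finite F" using F(1) insert.hyps(1) by (meson finite_Un finite_converse finite_subset)
  obtain e' where e': "e' = (x, y) \<or> e' = (y, x)" "potential V (insert e' F) \<le> potential V F"
    using potential_insert_le[OF fin new] by blast
  have "insert e' F \<subseteq> insert e R \<union> (insert e R)\<inverse>"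
    using e' F(1) by (auto simp: e)
  moreover have "antisym (insert e' F)"
    using e'(1) new F(2) by (auto simp: antisym_def)
  moreover have "card (insert e' F) = card (insert e R)"
    using e'(1) new F(3) fin insert.hyps by auto
  ultimately show ?case using e'(2) F(4) by (meson order_trans)
qed

text \<open>With u = 11/10 and t = 2 e(A,B) - 3 e(B,A), the summand u^t is at most the potential,
  which is at most its initial value 4^(\<open>card V\<close>), the number of pairs. As
  \<open>4 \<le> u^15\<close>, this bounds t by \<open>15 * card V\<close>.\<close>

lemma exists_balanced_orientation:
  fixes R :: "'a :: linorder rel"
  assumes "finite V" "R \<subseteq> V \<times> V" "\<And>x y. (x, y) \<in> R \<Longrightarrow> x < y"
  obtains H where "oriented_graph H" "pverts H = V" "parcs H \<subseteq> R \<union> R\<inverse>" "card (parcs H) = card R"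
    "\<And>A B. A \<subseteq> V \<Longrightarrow> B \<subseteq> V \<Longrightarrow> 2 * arcs_between H A B \<le> 3 * arcs_between H B A + 15 * card V"
proof -
  have "finite R" using assms(1,2) by (meson finite_SigmaI finite_subset)
  then obtain F where F: "F \<subseteq> R \<union> R\<inverse>" "antisym F" "card F = card R" "potential V F \<le> potential V {}"
    using exists_orientation_low_potential[of R V] assms(3) by blast
  have finF: "finite F" using F(1) \<open>finite R\<close> by (meson finite_Un finite_converse finite_subset)
  have potential_empty: "potential V {} = 4 ^ card V"
    using assms(1)
    by (simp add: potential_def card_cartesian_product card_Pow flip: power_mult_distrib)
  define H where "H = \<lparr>pverts = V, parcs = F\<rparr>"
  have "x \<noteq> y \<and> x \<in> V \<and> y \<in> V" if "(x, y) \<in> F" for x y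
    using that F(1) assms(2,3) by blast
  then have "oriented_graph H"
    unfolding oriented_graph_def using F(2) assms(1) finF
    by (auto simp: H_def intro!: pair_digraph.intro pair_fin_digraph.intro pair_wf_digraph.intro
        pair_fin_digraph_axioms.intro pair_loopfree_digraph.intro pair_loopfree_digraph_axioms.intro)
  moreover have "2 * arcs_between H A B \<le> 3 * arcs_between H B A + 15 * card V"
    if AB: "A \<subseteq> V" "B \<subseteq> V" for A B
  proof -
    let ?t = "2 * real (arcs_between H A B) - 3 * real (arcs_between H B A)"
    have count: "(\<Sum>e\<in>F. of_bool (fst e \<in> P \<and> snd e \<in> Q)) = real (arcs_between H P Q)" for P Q
      using finF by (simp add: arcs_between_def H_def of_bool_def sum.If_cases case_prod_unfold Int_def)
    have "(11 / 10) powr ?t = (11 / 10) powr (\<Sum>e\<in>F. imbalance A B e)"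
      by (simp add: imbalance_def case_prod_unfold sum_subtractf count flip: sum_distrib_left)
    also have "\<dots> = (\<Prod>e\<in>F. (11 / 10) powr imbalance A B e)"
      by (simp add: powr_sum finF)
    also have "\<dots> \<le> potential V F"
      unfolding potential_def using AB assms(1)
      using member_le_sum[of "(A, B)" "Pow V \<times> Pow V" "\<lambda>(A, B). \<Prod>e\<in>F. (11 / 10) powr imbalance A B e"]
      by (simp add: prod_nonneg case_prod_unfold)
    also have "\<dots> \<le> 4 ^ card V" using F(4) potential_empty by simp
    also have "\<dots> \<le> ((11 / 10) ^ 15) ^ card V"
      by (intro power_mono) (auto simp: power_numeral_reduce)
    also have "\<dots> = (11 / 10 :: real) powr (15 * real (card V))"
      using powr_realpow[of "11 / 10" "15 * card V"] by (simp add: power_mult)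
    finally have "?t \<le> 15 * real (card V)" by simp
    then show ?thesis by linarith
  qed
  ultimately show ?thesis using F(1,3) by (intro that[of H]) (auto simp: H_def)
qed

section \<open>Blow-ups\<close>

definition blow_up :: "nat \<Rightarrow> nat \<Rightarrow> nat pair_pre_digraph \<Rightarrow> nat pair_pre_digraph" where
  "blow_up m l H = \<lparr>pverts = {..<m * l},
     parcs = {(v, w). v < m * l \<and> w < m * l \<and> (v mod m, w mod m) \<in> parcs H}\<rparr>"

text \<open>Vertex s * m + i of the blow-up is the s-th copy of vertex i.\<close>

definition layer :: "nat \<Rightarrow> nat set \<Rightarrow> nat \<Rightarrow> nat set" where
  "layer m A s = {i. i < m \<and> s * m + i \<in> A}"

text \<open>Division with remainder by \<open>m\<close> splits an arc into two copy indices and an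
  arc of \<open>H\<close>. This is the bilinearity that lets estimates for \<open>H\<close> be
  summed over pairs of layers.\<close>

lemma arcs_between_blow_up:
  assumes "pair_fin_digraph H" "pverts H = {..<m}"
  shows "arcs_between (blow_up m l H) A B
    = (\<Sum>(s, t)\<in>{..<l} \<times> {..<l}. arcs_between H (layer m A s) (layer m B t))"
proof -
  interpret pair_fin_digraph H by fact
  have lt: "i < m" "j < m" if "(i, j) \<in> parcs H" for i j
    using that in_arcsD1 in_arcsD2 assms(2) by auto
  have lt2: "i + s * m < l * m" if "s < l" "i < m" for s i
  proof -
    have "i + s * m < Suc s * m" using that by simp
    also have "\<dots> \<le> l * m" using that by (intro mult_le_mono) auto
    finally show ?thesis .
  qed
  let ?X = "\<lambda>(s, t). {(x, y) \<in> parcs H. x \<in> layer m A s \<and> y \<in> layer m B t}"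
  let ?Y = "{(v, w) \<in> parcs (blow_up m l H). v \<in> A \<and> w \<in> B}"
  have "bij_betw (\<lambda>((s, t), (i, j)). (s * m + i, t * m + j)) (Sigma ({..<l} \<times> {..<l}) ?X) ?Y"
    by (rule bij_betw_byWitness[where f' = "\<lambda>(v, w). ((v div m, w div m), (v mod m, w mod m))"])
      (auto simp: blow_up_def layer_def lt lt2 less_mult_imp_div_less ac_simps dest: lt)
  then have "arcs_between (blow_up m l H) A B = card (Sigma ({..<l} \<times> {..<l}) ?X)"
    unfolding arcs_between_def by (simp add: bij_betw_same_card)
  also have "\<dots> = (\<Sum>(s, t)\<in>{..<l} \<times> {..<l}. arcs_between H (layer m A s) (layer m B t))"
    by (subst card_SigmaI)
      (auto simp: arcs_between_def intro!: sum.cong intro: finite_subset[OF _ pair_finite_arcs])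
  finally show ?thesis .
qed

lemma card_parcs_blow_up:
  assumes "pair_fin_digraph H" "pverts H = {..<m}"
  shows "card (parcs (blow_up m l H)) = card (parcs H) * l ^ 2"
proof -
  interpret pair_fin_digraph H by fact
  have "{(x, y) \<in> parcs H. x < m \<and> y < m} = parcs H"
    using in_arcsD1 in_arcsD2 assms(2) by auto
  then show ?thesis
    using arcs_between_blow_up[OF assms, of l UNIV UNIV]
    by (simp add: arcs_between_def layer_def power2_eq_square)
qed

lemma oriented_graph_blow_up:
  assumes "oriented_graph H"
  shows "oriented_graph (blow_up m l H)"
proof -
  interpret pair_digraph H using assms by (simp add: oriented_graph_def)
  \<comment> \<open>Opposite arcs in the blow-up would, by antisymmetry of \<open>H\<close>, join
    two copies of one vertex and so project to a loop.\<close>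
  have irrefl: "(x, x) \<notin> parcs H" for x using pair_no_loops by fastforce
  have "finite (parcs (blow_up m l H))"
    by (rule finite_subset[of _ "{..<m * l} \<times> {..<m * l}"]) (auto simp: blow_up_def)
  moreover have "antisym (parcs (blow_up m l H))"
    using assms irrefl unfolding oriented_graph_def antisym_def blow_up_def by force
  ultimately show ?thesis
    unfolding oriented_graph_def using irrefl
    by (auto simp: blow_up_def intro!: pair_digraph.intro pair_fin_digraph.intro pair_wf_digraph.intro
        pair_fin_digraph_axioms.intro pair_loopfree_digraph.intro pair_loopfree_digraph_axioms.intro)
qed

text \<open>A four-cycle projects to a closed walk in \<open>H\<close>, which must backtrack.
  Backtracking gives two opposite arcs, impossible in an oriented graph.\<close>

lemma no_oriented_four_cycle_blow_up:
  assumes "oriented_graph H" "four_cycle_free (parcs H)"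
  shows "\<not> has_oriented_four_cycle (blow_up m l H)"
proof
  assume "has_oriented_four_cycle (blow_up m l H)"
  then obtain a b c d where *: "(a, b) \<in> parcs H" "(b, c) \<in> parcs H" "(c, d) \<in> parcs H" "(d, a) \<in> parcs H"
    by (auto simp: has_oriented_four_cycle_def blow_up_def)
  interpret pair_digraph H using assms(1) by (simp add: oriented_graph_def)
  have "a = c \<or> b = d" using assms(2) * unfolding four_cycle_free_def by blast
  moreover have "x = y" if "(x, y) \<in> parcs H" "(y, x) \<in> parcs H" for x y
    using assms(1) that by (auto simp: oriented_graph_def antisym_def)
  ultimately show False using * pair_no_loops by (metis fst_conv snd_conv)
qed

lemma bias_leI:
  assumes "finite (pverts D)"
    "\<And>A B. A \<subseteq> pverts D \<Longrightarrow> B \<subseteq> pverts D \<Longrightarrow> 2 * arcs_between D B A \<le> arcs_between D A B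
      \<Longrightarrow> arcs_between D A B \<le> N"
  shows "bias D \<le> N"
  unfolding bias_def using bias_set_finite_nonempty[OF assms(1)]
  by (subst Max_le_iff) (auto intro!: assms(2))

text \<open>Summing over the l^2 pairs of layers gives
  \<open>2 e(A,B) \<le> 3 e(B,A) + c l^2\<close>. The bias condition bounds 3 e(B,A) by 3/2 e(A,B),
  so half of e(A,B) is at most c l^2.\<close>

lemma bias_blow_up_le:
  assumes "pair_fin_digraph H" "pverts H = {..<m}"
    "\<And>A B. A \<subseteq> {..<m} \<Longrightarrow> B \<subseteq> {..<m} \<Longrightarrow> 2 * arcs_between H A B \<le> 3 * arcs_between H B A + c"
  shows "bias (blow_up m l H) \<le> 2 * c * l ^ 2"
proof (rule bias_leI)
  show "finite (pverts (blow_up m l H))" by (simp add: blow_up_def)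
next
  fix A B
  let ?D = "blow_up m l H"
  assume half: "2 * arcs_between ?D B A \<le> arcs_between ?D A B"
  have "2 * arcs_between ?D A B
      = (\<Sum>(s, t)\<in>{..<l} \<times> {..<l}. 2 * arcs_between H (layer m A s) (layer m B t))"
    by (simp add: arcs_between_blow_up[OF assms(1,2)] sum_distrib_left case_prod_unfold)
  also have "\<dots> \<le> (\<Sum>(s, t)\<in>{..<l} \<times> {..<l}. 3 * arcs_between H (layer m B t) (layer m A s) + c)"
    by (intro sum_mono) (auto simp: layer_def intro!: assms(3))
  also have "\<dots> = 3 * (\<Sum>(s, t)\<in>{..<l} \<times> {..<l}. arcs_between H (layer m B t) (layer m A s)) + c * l ^ 2"
    by (simp add: sum.distrib sum_distrib_left case_prod_unfold power2_eq_square)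
  also have "(\<Sum>(s, t)\<in>{..<l} \<times> {..<l}. arcs_between H (layer m B t) (layer m A s)) = arcs_between ?D B A"
    unfolding arcs_between_blow_up[OF assms(1,2)]
      sum.cartesian_product[symmetric] by (rule sum.swap)
  finally show "arcs_between ?D A B \<le> 2 * c * l ^ 2" using half by simp
qed

section \<open>Comparison of the bias with the squared arc density\<close>

theorem mainTheorem6:
  shows "\<exists>K C :: real. K > 0 \<and> C > 0 \<and>
    (\<forall>m l :: nat. m \<ge> 2 \<longrightarrow> l \<ge> 1 \<longrightarrow>
      (\<exists>D :: nat pair_pre_digraph.
         oriented_graph D \<and> card (pverts D) = m * l \<and>
         \<not> has_oriented_four_cycle D \<and>
         1 / 20 * real m powr (3 / 2) * real l ^ 2 \<le> real (card (parcs D)) \<and>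
         real (card (parcs D)) \<le> C * real m powr (3 / 2) * real l ^ 2 \<and>
         real (bias D) < K * real (card (parcs D)) ^ 2 / real (m * l) ^ 2))"
\<comment> \<open>The bias is at most 30 m l^2, and e(D)^2 / n^2 is at least m l^2 / 400 by the
  factor 1/20 in the lower bound. So 12000 would give the weak inequality, and 12001 makes it
  strict.\<close>
proof (rule exI[of _ 12001], rule exI[of _ 1], intro conjI allI impI)
  fix m l :: nat
  assume ml: "m \<ge> 2" "l \<ge> 1"
  obtain R :: "nat rel" where R: "R \<subseteq> {..<m} \<times> {..<m}" "\<And>i j. (i, j) \<in> R \<Longrightarrow> i < j"
    "four_cycle_free (R \<union> R\<inverse>)" "1 / 20 * real m powr (3 / 2) \<le> real (card R)"
    "real (card R) \<le> real m powr (3 / 2)"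
    using exists_dense_four_cycle_free[OF ml(1)] by metis
  obtain H where H: "oriented_graph H" "pverts H = {..<m}" "parcs H \<subseteq> R \<union> R\<inverse>"
    "card (parcs H) = card R"
    "\<And>A B. A \<subseteq> {..<m} \<Longrightarrow> B \<subseteq> {..<m} \<Longrightarrow>
       2 * arcs_between H A B \<le> 3 * arcs_between H B A + 15 * m"
    using exists_balanced_orientation[OF _ R(1,2)] by auto
  have fin: "pair_fin_digraph H"
    using H(1) by (simp add: oriented_graph_def pair_digraph_def)
  let ?D = "blow_up m l H"
  have card: "real (card (parcs ?D)) = real (card R) * real l ^ 2"
    by (simp add: card_parcs_blow_up[OF fin H(2)] H(4))
  have lower: "1 / 20 * real m powr (3 / 2) * real l ^ 2 \<le> real (card (parcs ?D))"
    unfolding card using R(4) by (rule mult_right_mono) simp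
  have "real (bias ?D) \<le> 30 * real m * real l ^ 2"
    using of_nat_mono[OF bias_blow_up_le[OF fin H(2,5), of l], where 'a = real] by simp
  also have "\<dots> < 12001 / 400 * real m * real l ^ 2"
    using ml by simp
  also have "\<dots> = 12001 * (1 / 20 * real m powr (3 / 2) * real l ^ 2) ^ 2 / real (m * l) ^ 2"
  proof -
    have "(real m powr (3 / 2)) ^ 2 = real m ^ 3"
      using ml by (simp add: power2_eq_square flip: powr_add)
    then show ?thesis
      using ml by (simp add: power_mult_distrib field_simps power_numeral_reduce)
  qed
  also have "\<dots> \<le> 12001 * real (card (parcs ?D)) ^ 2 / real (m * l) ^ 2"
    using lower by (intro divide_right_mono mult_left_mono power_mono) auto
  finally have "real (bias ?D) < 12001 * real (card (parcs ?D)) ^ 2 / real (m * l) ^ 2" .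
  moreover have "real (card (parcs ?D)) \<le> 1 * real m powr (3 / 2) * real l ^ 2"
    unfolding card using R(5) by (simp add: mult_right_mono)
  moreover have "four_cycle_free (parcs H)"
    using R(3) H(3) by (rule four_cycle_free_subset)
  ultimately show "\<exists>D :: nat pair_pre_digraph.
         oriented_graph D \<and> card (pverts D) = m * l \<and>
         \<not> has_oriented_four_cycle D \<and>
         1 / 20 * real m powr (3 / 2) * real l ^ 2 \<le> real (card (parcs D)) \<and>
         real (card (parcs D)) \<le> 1 * real m powr (3 / 2) * real l ^ 2 \<and>
         real (bias D) < 12001 * real (card (parcs D)) ^ 2 / real (m * l) ^ 2"
    using lower oriented_graph_blow_up[OF H(1)] no_oriented_four_cycle_blow_up[OF H(1)]
    by (intro exI[of _ ?D]) (auto simp: blow_up_def)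
qed simp_all

end
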